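(* Suppose that $G$ is a left-orderable group and that $$1\rightarrow K\rightarrow G\rightarrow \mathbb{Z}\rightarrow 1$$ is a short exact sequence of groups. Suppose that $\mathrm{Aut}(K)$ acts faithfully on $\mathrm{LO}(K)$. If conjugation by the generator of $\mathbb{Z}$ preserves a left-ordering of $K$ (that is, there are an element $t\in G$ mapping to a generator of $\mathbb{Z}$ and a positive cone $P_K\in\mathrm{LO}(K)$ such that $tP_Kt^{-1}=P_K$), then $\mathrm{Aut}(G)$ acts faithfully on $\mathrm{LO}(G)$.
   Context: A left-ordering of a group $G$ is a strict total ordering $<$ of $G$ such that $g<h$ implies $fg<fh$ for all $f,g,h\in G$; $G$ is left-orderable if it admits one. A left-ordering is identified with its positive cone $P=\{g\in G\mid g>1\}$; the positive cones are exactly the subsets $P\subset G$ with $P\cdot P\subset P$ and $G=P\sqcup P^{-1}\sqcup\{1\}$. $\mathrm{LO}(G)$ denotes the set of all positive cones of left-orderings of $G$, and $\mathrm{Aut}(G)$ acts on $\mathrm{LO}(G)$ by $P\mapsto\phi(P)$ for $\phi\in\mathrm{Aut}(G)$. In the short exact sequence, $K$ is identified with its image in $G$, a normal subgroup. *)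

theory Defs
  imports "HOL-Algebra.Algebra"
begin

text \<open>Orderings live on the carrier only; the pair \<open>(g, h)\<close> in the relation means \<open>g < h\<close>.\<close>

definition left_ordering :: "('a, 'b) monoid_scheme \<Rightarrow> 'a rel \<Rightarrow> bool"
  where "left_ordering G r \<longleftrightarrow>
    r \<subseteq> carrier G \<times> carrier G \<and>
    strict_linear_order_on (carrier G) r \<and>
    (\<forall>f\<in>carrier G. \<forall>g\<in>carrier G. \<forall>h\<in>carrier G.
      (g, h) \<in> r \<longrightarrow> (f \<otimes>\<^bsub>G\<^esub> g, f \<otimes>\<^bsub>G\<^esub> h) \<in> r)"

definition left_orderable :: "('a, 'b) monoid_scheme \<Rightarrow> bool"
  where "left_orderable G \<longleftrightarrow> (\<exists>r. left_ordering G r)"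

definition positive_cone :: "('a, 'b) monoid_scheme \<Rightarrow> 'a rel \<Rightarrow> 'a set"
  where "positive_cone G r = {g \<in> carrier G. (\<one>\<^bsub>G\<^esub>, g) \<in> r}"

definition LO :: "('a, 'b) monoid_scheme \<Rightarrow> 'a set set"
  where "LO G = {positive_cone G r |r. left_ordering G r}"

text \<open>The restriction to \<open>LO G\<close> is needed because \<^const>\<open>BijGroup\<close> consists of extensional maps.\<close>

definition Aut_LO_action :: "('a, 'b) monoid_scheme \<Rightarrow> ('a \<Rightarrow> 'a) \<Rightarrow> 'a set \<Rightarrow> 'a set"
  where "Aut_LO_action G \<phi> = (\<lambda>P\<in>LO G. \<phi> ` P)"

lemma (in group) positive_cone_mem_LO_iff:
  "P \<in> LO G \<longleftrightarrow>
    P \<subseteq> carrier G \<and> P <#> P \<subseteq> P \<and>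
    carrier G = P \<union> set_inv P \<union> {\<one>} \<and>
    P \<inter> set_inv P = {} \<and> \<one> \<notin> P \<and> \<one> \<notin> set_inv P"
  (is "_ \<longleftrightarrow> ?cone")
proof
  assume "P \<in> LO G"
  then obtain r where P: "P = positive_cone G r" and r: "left_ordering G r"
    by (auto simp: LO_def)
  have sub: "r \<subseteq> carrier G \<times> carrier G" and tr: "trans r" and ir: "irrefl r"
    and tot: "total_on (carrier G) r"
    and inva: "\<And>f g h. \<lbrakk>f \<in> carrier G; (g, h) \<in> r\<rbrakk> \<Longrightarrow> (f \<otimes> g, f \<otimes> h) \<in> r"
    using r by (auto simp: left_ordering_def strict_linear_order_on_def)
  have Psub: "P \<subseteq> carrier G" and Piff: "\<And>g. g \<in> P \<longleftrightarrow> (\<one>, g) \<in> r"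
    using sub by (auto simp: P positive_cone_def)
  have mult: "P <#> P \<subseteq> P"
  proof
    fix x assume "x \<in> P <#> P"
    then obtain a b where ab: "a \<in> P" "b \<in> P" "x = a \<otimes> b" by (auto simp: set_mult_def)
    then have "(a \<otimes> \<one>, a \<otimes> b) \<in> r" using inva Psub Piff by blast
    then have "(a, x) \<in> r" using ab Psub by auto
    then show "x \<in> P" using ab Piff tr by (meson transD)
  qed
  have one: "\<one> \<notin> P" using ir by (auto simp: Piff irrefl_def)
  then have one': "\<one> \<notin> set_inv P"
    using Psub by (auto simp: SET_INV_def) (metis inv_inv inv_one subsetD)
  have disj: "P \<inter> set_inv P = {}"
  proof (rule ccontr)
    assume "\<not> ?thesis"
    then obtain a where "a \<in> P" "inv a \<in> P" by (auto simp: SET_INV_def)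
    then have "a \<otimes> inv a \<in> P" using mult by (auto simp: set_mult_def)
    then show False using one \<open>a \<in> P\<close> Psub by auto
  qed
  have "g \<in> P \<union> set_inv P \<union> {\<one>}" if g: "g \<in> carrier G" for g
  proof (cases "g = \<one>")
    case False
    then consider "(\<one>, g) \<in> r" | "(g, \<one>) \<in> r"
      using tot g unfolding total_on_def by (metis one_closed)
    then show ?thesis
    proof cases
      case 1 then show ?thesis using Piff by simp
    next
      case 2
      then have "(inv g \<otimes> g, inv g \<otimes> \<one>) \<in> r" using inva g by blast
      then have "inv g \<in> P" using g Piff by simp
      then have "inv (inv g) \<in> set_inv P" by (auto simp: SET_INV_def)
      then show ?thesis using g by simp
    qed
  qed simp
  then have "carrier G = P \<union> set_inv P \<union> {\<one>}" using Psub by (auto simp: SET_INV_def)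
  then show ?cone using Psub mult one one' disj by blast
next
  assume c: ?cone
  define r where "r = {(g, h). g \<in> carrier G \<and> h \<in> carrier G \<and> inv g \<otimes> h \<in> P}"
  have mult: "\<And>a b. \<lbrakk>a \<in> P; b \<in> P\<rbrakk> \<Longrightarrow> a \<otimes> b \<in> P"
    using c by (auto simp: set_mult_def)
  have invm: "\<And>a. a \<in> set_inv P \<Longrightarrow> inv a \<in> P"
    using c by (auto simp: SET_INV_def)
  have "trans r"
  proof (rule transI)
    fix x y z assume "(x, y) \<in> r" "(y, z) \<in> r"
    then have *: "x \<in> carrier G" "y \<in> carrier G" "z \<in> carrier G"
      "(inv x \<otimes> y) \<otimes> (inv y \<otimes> z) \<in> P" using mult by (auto simp: r_def)
    moreover have "(inv x \<otimes> y) \<otimes> (inv y \<otimes> z) = inv x \<otimes> z"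
      using * by (metis inv_closed inv_solve_left m_assoc m_closed)
    ultimately show "(x, z) \<in> r" by (simp add: r_def)
  qed
  moreover have "irrefl r" using c by (auto simp: r_def irrefl_def)
  moreover have "total_on (carrier G) r"
  proof (rule total_onI)
    fix x y assume xy: "x \<in> carrier G" "y \<in> carrier G" "x \<noteq> y"
    have "inv x \<otimes> y \<noteq> \<one>" using xy by (metis inv_equality inv_closed inv_inv)
    then consider "inv x \<otimes> y \<in> P" | "inv x \<otimes> y \<in> set_inv P" using c xy by blast
    then show "(x, y) \<in> r \<or> (y, x) \<in> r"
    proof cases
      case 2
      then have "inv (inv x \<otimes> y) \<in> P" by (rule invm)
      then show ?thesis using xy by (simp add: r_def inv_mult_group)
    qed (use xy in \<open>simp add: r_def\<close>)
  qed
  moreover have "(f \<otimes> g, f \<otimes> h) \<in> r" if "f \<in> carrier G" "(g, h) \<in> r" for f g h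
  proof -
    have gh: "g \<in> carrier G" "h \<in> carrier G" "inv g \<otimes> h \<in> P" using that by (auto simp: r_def)
    have "inv (f \<otimes> g) \<otimes> (f \<otimes> h) = inv g \<otimes> h"
      using that(1) gh by (simp add: inv_mult_group m_assoc) (metis inv_closed l_inv l_one m_assoc)
    then show ?thesis using that(1) gh by (simp add: r_def)
  qed
  ultimately have "left_ordering G r"
    by (auto simp: left_ordering_def strict_linear_order_on_def r_def)
  moreover have "P = positive_cone G r" using c by (auto simp: positive_cone_def r_def)
  ultimately show "P \<in> LO G" by (auto simp: LO_def)
qed

lemma (in group) Aut_LO_action_closed:
  assumes "\<phi> \<in> auto G" "P \<in> LO G"
  shows "\<phi> ` P \<in> LO G"
proof -
  interpret h: group_hom G G \<phi>
    using assms(1) by unfold_locales (auto simp: auto_def)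
  have bij: "bij_betw \<phi> (carrier G) (carrier G)" using assms(1) by (auto simp: auto_def Bij_def)
  note c = assms(2)[unfolded positive_cone_mem_LO_iff]
  have sub: "P \<subseteq> carrier G" using c by blast
  have isub: "set_inv P \<subseteq> carrier G" using c by blast
  have si: "set_inv (\<phi> ` P) = \<phi> ` (set_inv P)"
  proof -
    have "\<phi> (inv x) = inv (\<phi> x)" if "x \<in> P" for x using that sub by auto
    then have "inv (\<phi> x) \<in> \<phi> ` (set_inv P)" "\<phi> (inv x) \<in> set_inv (\<phi> ` P)" if "x \<in> P" for x
      using that unfolding SET_INV_def by (metis UN_iff imageI singletonI)+
    then show ?thesis by (auto simp: SET_INV_def)
  qed
  have inj: "inj_on \<phi> (carrier G)" using bij by (simp add: bij_betw_def)
  have im: "\<phi> ` carrier G = carrier G" using bij by (simp add: bij_betw_def)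
  have "\<phi> ` P \<subseteq> carrier G" using sub by auto
  moreover have "\<phi> ` P <#> \<phi> ` P \<subseteq> \<phi> ` P"
  proof
    fix x assume "x \<in> \<phi> ` P <#> \<phi> ` P"
    then obtain a b where ab: "a \<in> P" "b \<in> P" "x = \<phi> a \<otimes> \<phi> b" by (auto simp: set_mult_def)
    then have "x = \<phi> (a \<otimes> b)" using sub by (auto simp: subset_iff)
    moreover have "a \<otimes> b \<in> P" using ab c by (auto simp: set_mult_def)
    ultimately show "x \<in> \<phi> ` P" by blast
  qed
  moreover have "carrier G = \<phi> ` P \<union> \<phi> ` (set_inv P) \<union> {\<one>}"
  proof -
    have "\<phi> ` carrier G = \<phi> ` (P \<union> set_inv P \<union> {\<one>})" using c by auto
    then show ?thesis using im by (simp add: image_Un)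
  qed
  moreover have "\<phi> ` P \<inter> \<phi> ` (set_inv P) = {}"
    using inj_on_image_Int[OF inj sub isub] c by auto
  moreover have "\<one> \<notin> \<phi> ` A" if "A \<subseteq> carrier G" "\<one> \<notin> A" for A
  proof
    assume "\<one> \<in> \<phi> ` A"
    then obtain a where "a \<in> A" "\<phi> a = \<phi> \<one>" by auto
    then show False using inj that by (metis inj_onD one_closed subsetD)
  qed
  moreover have "\<one> \<notin> P" "\<one> \<notin> set_inv P" using c by auto
  ultimately show ?thesis
    unfolding positive_cone_mem_LO_iff si using sub isub by (intro conjI) simp_all
qed

lemma (in group) group_action_Aut_LO:
  "group_action (AutoGroup G) (LO G) (Aut_LO_action G)"
proof -
  have car: "carrier (AutoGroup G) = auto G" by (simp add: AutoGroup_def)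
  have mul: "\<phi> \<otimes>\<^bsub>AutoGroup G\<^esub> \<psi> = compose (carrier G) \<phi> \<psi>" if "\<phi> \<in> auto G" "\<psi> \<in> auto G" for \<phi> \<psi>
    using that by (auto simp: AutoGroup_def BijGroup_def auto_def)
  have Bi: "Aut_LO_action G \<phi> \<in> Bij (LO G)" if f: "\<phi> \<in> auto G" for \<phi>
  proof -
    have bij: "bij_betw \<phi> (carrier G) (carrier G)" using f by (auto simp: auto_def Bij_def)
    have sub: "\<And>P. P \<in> LO G \<Longrightarrow> P \<subseteq> carrier G" by (auto simp: LO_def positive_cone_def)
    have "inj_on (image \<phi>) (LO G)"
      using bij sub by (meson bij_betw_def inj_on_image_eq_iff inj_onI)
    moreover have "image \<phi> ` LO G = LO G"
    proof (intro equalityI subsetI)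
      fix P assume P: "P \<in> LO G"
      let ?q = "restrict (inv_into (carrier G) \<phi>) (carrier G)"
      have "\<phi> \<in> iso G G" using f by (auto simp: auto_def Bij_def iso_def)
      then have "inv_into (carrier G) \<phi> \<in> iso G G" by (rule iso_set_sym)
      then have "?q \<in> auto G"
        by (auto simp: auto_def Bij_def iso_def hom_def bij_betw_def inj_on_def)
      then have "?q ` P \<in> LO G" using P by (rule Aut_LO_action_closed)
      moreover have "\<phi> ` ?q ` P = P"
      proof -
        have "\<phi> (?q x) = x" if "x \<in> P" for x
          using that sub[OF P] bij by (auto simp: bij_betw_def f_inv_into_f subset_iff)
        then have "(\<lambda>x. \<phi> (?q x)) ` P = (\<lambda>x. x) ` P" by (rule image_cong[OF refl])
        then show ?thesis by (simp only: image_image image_ident)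
      qed
      ultimately show "P \<in> image \<phi> ` LO G" by (metis image_eqI)
    qed (use f Aut_LO_action_closed in auto)
    ultimately show ?thesis
      by (auto simp: Bij_def bij_betw_def Aut_LO_action_def inj_on_def)
  qed
  have "Aut_LO_action G (compose (carrier G) \<phi> \<psi>)
      = compose (LO G) (Aut_LO_action G \<phi>) (Aut_LO_action G \<psi>)"
    if "\<phi> \<in> auto G" "\<psi> \<in> auto G" for \<phi> \<psi>
  proof
    fix P
    show "Aut_LO_action G (compose (carrier G) \<phi> \<psi>) P
        = compose (LO G) (Aut_LO_action G \<phi>) (Aut_LO_action G \<psi>) P"
    proof (cases "P \<in> LO G")
      case True
      then have "P \<subseteq> carrier G" by (auto simp: LO_def positive_cone_def)
      then show ?thesis using True Aut_LO_action_closed[OF that(2) True]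
        by (auto simp: Aut_LO_action_def compose_def image_image subset_iff intro!: image_cong)
    qed (simp add: Aut_LO_action_def compose_def)
  qed
  then have "Aut_LO_action G \<in> hom (AutoGroup G) (BijGroup (LO G))"
    using Bi by (auto simp: hom_def car mul) (auto simp: BijGroup_def Bi)
  then show ?thesis
    by (simp add: group_action_def group_hom_def group_hom_axioms_def AutoGroup group_BijGroup)
qed

end

theory Submission
  imports Defs
begin

text \<open>
  Let \<open>L\<close> be a subgroup of \<open>G\<close> and suppose that the elements outside \<open>L\<close> are split into a positive part
  \<open>A\<close> and its inverse, where \<open>A\<close> is closed under products and absorbs \<open>L\<close> on both sides; such an \<open>A\<close> is
  called a cone relative to \<open>L\<close> below. Every positive cone \<open>Q\<close> of \<open>L\<close> then extends lexicographically to
  the positive cone \<open>A \<union> Q\<close> of \<open>G\<close>, in which \<open>L\<close> is convex. Reversing the order on \<open>L\<close> alone gives a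
  second positive cone \<open>A \<union> Q\<inverse>\<close>, and the two meet exactly in \<open>A\<close>. An automorphism that fixes every
  positive cone of \<open>G\<close> therefore maps each of \<open>A\<close>, \<open>Q\<close> and \<open>L\<close> onto itself
  (\<open>fixes_relative_cones\<close>, \<open>fixes_convex_subgroup\<close>).

  An extension \<open>G\<close> of the integers by \<open>K\<close> offers two such situations. In the first, \<open>L = K\<close> and \<open>A\<close>
  consists of the elements with positive image in the integers. An automorphism \<open>\<phi>\<close> of \<open>G\<close> that fixes
  every positive cone thus restricts to an automorphism of \<open>K\<close> that fixes every positive cone of \<open>K\<close>,
  and faithfulness for \<open>K\<close> makes that restriction the identity. In the second, \<open>L\<close> is the infinite
  cyclic group generated by \<open>t\<close> and \<open>A = P\<^sub>K L\<close>; conjugation by \<open>t\<close> preserving \<open>P\<^sub>K\<close> is what makes \<open>A\<close> a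
  cone relative to \<open>L\<close> (\<open>relative_cone_set_mult\<close>). So \<open>\<phi>\<close> also maps the set of positive powers of \<open>t\<close>
  onto itself, and hence fixes \<open>t\<close>. Since \<open>K\<close> and \<open>t\<close> generate \<open>G\<close>, \<open>\<phi>\<close> is the identity.
\<close>

section \<open>Relative cones\<close>

text \<open>
  The set \<open>A\<close> is meant to be the elements of \<open>H\<close> lying above the convex subgroup \<open>L\<close> in some left-ordering
  of \<open>H\<close>. The set \<open>H\<close> is determined by \<open>A\<close> and \<open>L\<close>; it is an argument so that a cone of \<open>H\<close> relative to
  \<open>L\<close> can be followed by a cone of \<open>L\<close> relative to a smaller subgroup. All conditions refer to the
  operations of the ambient group \<open>G\<close>, so that passing to a subgroup does not change the structure.
\<close>

definition relative_cone ::
    "('a, 'b) monoid_scheme \<Rightarrow> 'a set \<Rightarrow> 'a set \<Rightarrow> 'a set \<Rightarrow> bool"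
  where "relative_cone G H L A \<longleftrightarrow>
    A \<subseteq> carrier G \<and> subgroup L G \<and>
    (\<forall>a\<in>A. \<forall>b\<in>A \<union> L. a \<otimes>\<^bsub>G\<^esub> b \<in> A \<and> b \<otimes>\<^bsub>G\<^esub> a \<in> A) \<and>
    H = A \<union> set_inv\<^bsub>G\<^esub> A \<union> L \<and> A \<inter> L = {}"

context group
begin

lemma mem_set_inv_iff:
  assumes "A \<subseteq> carrier G"
  shows "x \<in> set_inv A \<longleftrightarrow> x \<in> carrier G \<and> inv x \<in> A"
  using assms by (auto simp: SET_INV_def subset_iff) (metis inv_inv)

lemma set_inv_set_inv:
  assumes "A \<subseteq> carrier G"
  shows "set_inv (set_inv A) = A"
proof -
  have "set_inv A \<subseteq> carrier G" using assms by (auto simp: mem_set_inv_iff)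
  then have "x \<in> set_inv (set_inv A) \<longleftrightarrow> x \<in> A" for x
    using assms by (simp add: mem_set_inv_iff) (metis inv_closed inv_inv subsetD)
  then show ?thesis by blast
qed

lemma relative_cone_disjoint_set_inv:
  assumes "relative_cone G H L A"
  shows "A \<inter> set_inv A = {}"
proof (rule ccontr)
  assume "\<not> ?thesis"
  with assms obtain a where a: "a \<in> A" "inv a \<in> A" "a \<in> carrier G"
    by (auto simp: relative_cone_def mem_set_inv_iff)
  then have "a \<otimes> inv a \<in> A" using assms unfolding relative_cone_def by (metis UnI1)
  moreover have "\<one> \<in> L" using assms by (auto simp: relative_cone_def subgroup.one_closed)
  ultimately show False using a assms by (auto simp: relative_cone_def)
qed

lemma LO_iff_relative_cone: "P \<in> LO G \<longleftrightarrow> relative_cone G (carrier G) {\<one>} P"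
proof
  assume P: "P \<in> LO G"
  note c = P[unfolded positive_cone_mem_LO_iff]
  have "a \<otimes> b \<in> P" if "a \<in> P" "b \<in> P" for a b
    using c that by (auto simp: set_mult_def)
  with c show "relative_cone G (carrier G) {\<one>} P"
    unfolding relative_cone_def using triv_subgroup by (auto simp: subset_iff)
next
  assume P: "relative_cone G (carrier G) {\<one>} P"
  have sub: "P \<subseteq> carrier G" and one: "\<one> \<notin> P"
    using P by (auto simp: relative_cone_def)
  then have "\<one> \<notin> set_inv P" by (simp add: mem_set_inv_iff)
  with P one sub relative_cone_disjoint_set_inv[OF P] show "P \<in> LO G"
    unfolding positive_cone_mem_LO_iff relative_cone_def set_mult_def by auto
qed

lemma relative_cone_set_inv:
  assumes "relative_cone G H L A"
  shows "relative_cone G H L (set_inv A)"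
proof -
  have sub: "A \<subseteq> carrier G" and L: "subgroup L G" and disj: "A \<inter> L = {}"
    and H: "H = A \<union> set_inv A \<union> L"
    and mult: "\<And>a b. \<lbrakk>a \<in> A; b \<in> A \<union> L\<rbrakk> \<Longrightarrow> a \<otimes> b \<in> A \<and> b \<otimes> a \<in> A"
    using assms by (auto simp: relative_cone_def)
  have Lsub: "L \<subseteq> carrier G" using L by (rule subgroup.subset)
  have isub: "set_inv A \<subseteq> carrier G" using sub by (auto simp: mem_set_inv_iff)
  have "a \<otimes> b \<in> set_inv A \<and> b \<otimes> a \<in> set_inv A"
    if a: "a \<in> set_inv A" and b: "b \<in> set_inv A \<union> L" for a b
  proof -
    have ac: "a \<in> carrier G" "inv a \<in> A" using a sub by (auto simp: mem_set_inv_iff)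
    have bc: "b \<in> carrier G" "inv b \<in> A \<union> L"
      using b sub Lsub subgroup.m_inv_closed[OF L] by (auto simp: mem_set_inv_iff)
    show ?thesis using ac bc mult[OF ac(2) bc(2)] sub by (simp add: mem_set_inv_iff inv_mult_group)
  qed
  moreover have "set_inv A \<inter> L = {}"
    using disj sub subgroup.m_inv_closed[OF L] by (auto simp: mem_set_inv_iff)
  ultimately show ?thesis
    using isub L H set_inv_set_inv[OF sub] by (auto simp: relative_cone_def)
qed

text \<open>
  The lexicographic construction: \<open>B\<close> decides only where \<open>A\<close> is silent. Products of an element of \<open>A\<close>
  with one of \<open>B\<close> stay in \<open>A\<close> because \<open>B\<close> lies in \<open>L\<close>.
\<close>

lemma relative_cone_concat:
  assumes A: "relative_cone G H L A" and B: "relative_cone G L M B"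
  shows "relative_cone G H M (A \<union> B)"
proof -
  have L: "L = B \<union> set_inv B \<union> M" using B by (simp add: relative_cone_def)
  have "set_inv (A \<union> B) = set_inv A \<union> set_inv B" by (auto simp: SET_INV_def)
  moreover have "A \<inter> L = {}" "B \<inter> M = {}" using A B by (auto simp: relative_cone_def)
  moreover have "a \<otimes> b \<in> A \<and> b \<otimes> a \<in> A" if "a \<in> A" "b \<in> A \<union> L" for a b
    using A that by (auto simp: relative_cone_def)
  moreover have "a \<otimes> b \<in> B \<and> b \<otimes> a \<in> B" if "a \<in> B" "b \<in> B \<union> M" for a b
    using B that by (auto simp: relative_cone_def)
  moreover have "H = A \<union> set_inv A \<union> L" "A \<subseteq> carrier G" "B \<subseteq> carrier G" "subgroup M G"
    using A B by (auto simp: relative_cone_def)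
  ultimately show ?thesis unfolding relative_cone_def by (simp only: L) blast
qed

text \<open>
  Both \<open>A\<close> and \<open>Q\<close> are Boolean combinations of the positive cones \<open>A \<union> Q\<close> and \<open>A \<union> Q\<inverse>\<close> of \<open>G\<close>, and an
  injective map that fixes two sets also fixes their intersection and their difference.
\<close>

lemma fixes_relative_cones:
  assumes inj: "inj_on \<phi> (carrier G)" and fix_LO: "\<And>P. P \<in> LO G \<Longrightarrow> \<phi> ` P = P"
    and A: "relative_cone G (carrier G) L A" and Q: "relative_cone G L {\<one>} Q"
  shows "\<phi> ` A = A" and "\<phi> ` Q = Q"
proof -
  have sub: "A \<subseteq> carrier G" "Q \<subseteq> carrier G" "set_inv Q \<subseteq> carrier G"
    using A Q by (auto simp: relative_cone_def mem_set_inv_iff)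
  have "A \<union> Q \<in> LO G" "A \<union> set_inv Q \<in> LO G"
    using relative_cone_concat[OF A Q] relative_cone_concat[OF A relative_cone_set_inv[OF Q]]
    by (simp_all add: LO_iff_relative_cone)
  then have f: "\<phi> ` (A \<union> Q) = A \<union> Q" "\<phi> ` (A \<union> set_inv Q) = A \<union> set_inv Q"
    using fix_LO by blast+
  have A_eq: "A = (A \<union> Q) \<inter> (A \<union> set_inv Q)"
    using relative_cone_disjoint_set_inv[OF Q] by blast
  have "\<phi> ` ((A \<union> Q) \<inter> (A \<union> set_inv Q)) = \<phi> ` (A \<union> Q) \<inter> \<phi> ` (A \<union> set_inv Q)"
    using sub by (intro inj_on_image_Int[OF inj]) auto
  then show fA: "\<phi> ` A = A" using f A_eq by simp
  have Q_eq: "Q = (A \<union> Q) - A"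
    using A Q by (auto simp: relative_cone_def)
  have "\<phi> ` ((A \<union> Q) - A) = \<phi> ` (A \<union> Q) - \<phi> ` A"
    using sub by (intro inj_on_image_set_diff[OF inj]) auto
  then show "\<phi> ` Q = Q" using f fA Q_eq by simp
qed

lemma fixes_convex_subgroup:
  assumes hom: "\<phi> \<in> hom G G"
    and inj: "inj_on \<phi> (carrier G)" and fix_LO: "\<And>P. P \<in> LO G \<Longrightarrow> \<phi> ` P = P"
    and A: "relative_cone G (carrier G) L A" and Q: "relative_cone G L {\<one>} Q"
  shows "\<phi> ` L = L"
proof -
  have "L = Q \<union> set_inv Q \<union> {\<one>}" using Q by (simp add: relative_cone_def)
  moreover have "\<phi> ` Q = Q" "\<phi> ` (set_inv Q) = set_inv Q"
    using fixes_relative_cones(2)[OF inj fix_LO A] Q relative_cone_set_inv[OF Q] by blast+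
  moreover have "\<phi> \<one> = \<one>" using hom hom_one group_axioms by blast
  ultimately show ?thesis by (simp add: image_Un)
qed

section \<open>Constructions of relative cones\<close>

lemma relative_cone_positive_hom:
  assumes "p \<in> hom G integer_group"
  shows "relative_cone G (carrier G) (kernel G integer_group p) {g \<in> carrier G. p g > 0}"
proof -
  interpret p: group_hom G integer_group p
    using assms by (simp add: group_hom_def group_hom_axioms_def)
  have eq: "p (a \<otimes> b) = p a + p b" if "a \<in> carrier G" "b \<in> carrier G" for a b
    using that by simp
  have eqi: "p (inv a) = - p a" if "a \<in> carrier G" for a
    using that by simp
  have sub: "{g \<in> carrier G. p g > 0} \<subseteq> carrier G" by blast
  have "carrier G = {g \<in> carrier G. p g > 0} \<union> set_inv {g \<in> carrier G. p g > 0}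
      \<union> kernel G integer_group p"
    by (auto simp: mem_set_inv_iff[OF sub] eqi kernel_def)
  then show ?thesis
    using p.subgroup_kernel sub unfolding relative_cone_def
    by (auto simp: kernel_def eq simp del: p.hom_mult)
qed

lemma relative_cone_positive_powers:
  assumes t: "t \<in> carrier G" and free: "\<And>n::int. t [^] n = \<one> \<Longrightarrow> n = 0"
  shows "relative_cone G (range (\<lambda>n::int. t [^] n)) {\<one>} ((\<lambda>n::int. t [^] n) ` {0<..})"
    (is "relative_cone G ?T {\<one>} ?A")
proof -
  have sub: "?A \<subseteq> carrier G" using t by auto
  have "a \<otimes> b \<in> ?A" if ab: "a \<in> ?A" "b \<in> ?A" for a b
  proof -
    obtain n m :: int where "a = t [^] n" "b = t [^] m" "n > 0" "m > 0" using ab by auto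
    then have "a \<otimes> b = t [^] (n + m)" "n + m > 0" using t by (auto simp: int_pow_mult)
    then show ?thesis by blast
  qed
  moreover have "?T = ?A \<union> set_inv ?A \<union> {\<one>}"
  proof (intro equalityI subsetI)
    fix x assume "x \<in> ?T"
    then obtain n :: int where n: "x = t [^] n" by auto
    consider "n > 0" | "n = 0" | "- n > 0" by linarith
    then show "x \<in> ?A \<union> set_inv ?A \<union> {\<one>}"
    proof cases
      case 3
      then have "inv x \<in> ?A" using n t int_pow_neg[OF t, of n] by (metis greaterThan_iff imageI)
      then show ?thesis using sub n t by (simp add: mem_set_inv_iff)
    qed (use n in auto)
  next
    fix x assume "x \<in> ?A \<union> set_inv ?A \<union> {\<one>}"
    then consider "x \<in> ?A" | "inv x \<in> ?A" "x \<in> carrier G" | "x = t [^] (0::int)"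
      using sub by (auto simp: mem_set_inv_iff)
    then show "x \<in> ?T"
    proof cases
      case 2
      then obtain n :: int where "inv x = t [^] n" by auto
      then have "x = t [^] (- n)" using 2 t by (metis int_pow_neg inv_inv)
      then show ?thesis by blast
    next
      case 3 then show ?thesis by (rule range_eqI)
    qed blast
  qed
  moreover have "\<one> \<notin> ?A" using free by force
  ultimately show ?thesis using triv_subgroup sub by (auto simp: relative_cone_def subset_iff)
qed

lemma relative_cone_image:
  assumes "group K" and \<iota>: "\<iota> \<in> mon K G" and Q: "Q \<in> LO K"
  shows "relative_cone G (\<iota> ` carrier K) {\<one>} (\<iota> ` Q)"
proof -
  interpret K: group K by fact
  interpret \<iota>: group_hom K G \<iota>
    using \<iota> by unfold_locales (auto simp: mon_def)
  have inj: "inj_on \<iota> (carrier K)" using \<iota> by (simp add: mon_def)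
  note c = Q[unfolded K.LO_iff_relative_cone relative_cone_def]
  have Qsub: "Q \<subseteq> carrier K" and carrier: "carrier K = Q \<union> set_inv\<^bsub>K\<^esub> Q \<union> {\<one>\<^bsub>K\<^esub>}"
    and one: "\<one>\<^bsub>K\<^esub> \<notin> Q"
    and mult: "\<And>a b. \<lbrakk>a \<in> Q; b \<in> Q\<rbrakk> \<Longrightarrow> a \<otimes>\<^bsub>K\<^esub> b \<in> Q"
    using c by auto
  have sub: "\<iota> ` Q \<subseteq> carrier G" using Qsub by auto
  have "a \<otimes> b \<in> \<iota> ` Q" if ab: "a \<in> \<iota> ` Q" "b \<in> \<iota> ` Q" for a b
  proof -
    obtain x y where xy: "x \<in> Q" "y \<in> Q" "a = \<iota> x" "b = \<iota> y" using ab by blast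
    then have "a \<otimes> b = \<iota> (x \<otimes>\<^bsub>K\<^esub> y)" using Qsub by (auto simp: subset_iff)
    then show ?thesis using mult xy by blast
  qed
  moreover have "\<iota> ` (set_inv\<^bsub>K\<^esub> Q) = set_inv (\<iota> ` Q)"
  proof -
    have "\<iota> (inv\<^bsub>K\<^esub> x) = inv (\<iota> x)" if "x \<in> Q" for x using that Qsub by auto
    then show ?thesis by (auto simp: SET_INV_def) (metis (no_types, lifting) UN_iff imageI singletonI)
  qed
  then have "\<iota> ` carrier K = \<iota> ` Q \<union> set_inv (\<iota> ` Q) \<union> {\<one>}"
    by (subst carrier) (simp add: image_Un)
  moreover have "\<one> \<notin> \<iota> ` Q"
  proof
    assume "\<one> \<in> \<iota> ` Q"
    then obtain x where "x \<in> Q" "\<iota> x = \<iota> \<one>\<^bsub>K\<^esub>" by auto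
    then show False using inj one Qsub by (metis K.one_closed inj_onD subsetD)
  qed
  ultimately show ?thesis using sub triv_subgroup unfolding relative_cone_def
    by (auto simp: subset_iff)
qed

text \<open>
  In a semidirect product \<open>N L\<close> the order may be dominated by \<open>N\<close> instead of by the quotient \<open>L\<close>, provided
  that \<open>L\<close> normalizes the positive cone \<open>Q\<close> of \<open>N\<close>. The normalization enters through
  \<open>l x = (l x l\<inverse>) l\<close>, which moves elements of \<open>L\<close> past those of \<open>Q\<close> without leaving \<open>Q\<close>; this gives closure
  under products and also identifies the inverses of elements of \<open>Q L\<close> with \<open>Q\<inverse> L\<close>.
\<close>

lemma relative_cone_set_mult:
  assumes Q: "relative_cone G N {\<one>} Q" and L: "subgroup L G"
    and norm: "L \<subseteq> normalizer G Q" and trivial: "N \<inter> L = {\<one>}"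
  shows "relative_cone G (N <#> L) L (Q <#> L)"
proof -
  have Qsub: "Q \<subseteq> carrier G" and N: "N = Q \<union> set_inv Q \<union> {\<one>}" and one: "\<one> \<notin> Q"
    and mult: "\<And>a b. \<lbrakk>a \<in> Q; b \<in> Q\<rbrakk> \<Longrightarrow> a \<otimes> b \<in> Q"
    using Q by (auto simp: relative_cone_def)
  have Lsub: "L \<subseteq> carrier G" using L by (rule subgroup.subset)
  have Nsub: "N \<subseteq> carrier G" using Qsub by (auto simp: N mem_set_inv_iff)
  have conj: "l \<otimes> x \<otimes> inv l \<in> Q" if "l \<in> L" "x \<in> Q" for l x
  proof -
    have "(l <# Q) #> inv l = Q"
      using norm that(1) Qsub by (auto simp: normalizer_def stabilizer_def)
    then show ?thesis using that(2) by (auto simp: l_coset_def r_coset_def)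
  qed
  have swap: "l \<otimes> x = (l \<otimes> x \<otimes> inv l) \<otimes> l" if "l \<in> L" "x \<in> Q" for l x
    using that Qsub Lsub by (auto simp: m_assoc subset_iff)
  have mem: "x \<otimes> l \<in> Q <#> L" if "x \<in> Q" "l \<in> L" for x l
    using that by (auto simp: set_mult_def)
  have sub: "Q <#> L \<subseteq> carrier G" using Qsub Lsub by (rule set_mult_closed)
  have left: "b \<otimes> a \<in> Q <#> L" if a: "a \<in> Q <#> L" and b: "b \<in> L" for a b
  proof -
    obtain x l where xl: "x \<in> Q" "l \<in> L" "a = x \<otimes> l" using a by (auto simp: set_mult_def)
    have c: "x \<in> carrier G" "l \<in> carrier G" "b \<in> carrier G" using xl b Qsub Lsub by auto
    have "b \<otimes> a = (b \<otimes> x \<otimes> inv b) \<otimes> (b \<otimes> l)"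
      using c xl(3) swap[OF b xl(1)] by (metis inv_closed m_assoc m_closed)
    then show ?thesis using mem conj xl b subgroup.m_closed[OF L] by metis
  qed
  have right: "a \<otimes> b \<in> Q <#> L" if a: "a \<in> Q <#> L" and b: "b \<in> L" for a b
  proof -
    obtain x l where xl: "x \<in> Q" "l \<in> L" "a = x \<otimes> l" using a by (auto simp: set_mult_def)
    have "a \<otimes> b = x \<otimes> (l \<otimes> b)" using xl b Qsub Lsub by (auto simp: m_assoc subset_iff)
    then show ?thesis using mem xl b subgroup.m_closed[OF L] by metis
  qed
  have Q_left: "b \<otimes> a \<in> Q <#> L" if a: "a \<in> Q <#> L" and b: "b \<in> Q" for a b
  proof -
    obtain x l where xl: "x \<in> Q" "l \<in> L" "a = x \<otimes> l" using a by (auto simp: set_mult_def)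
    have "b \<otimes> a = (b \<otimes> x) \<otimes> l" using xl b Qsub Lsub by (auto simp: m_assoc subset_iff)
    then show ?thesis using mem mult xl b by metis
  qed
  have both: "b \<otimes> a \<in> Q <#> L" if a: "a \<in> Q <#> L" and b: "b \<in> Q <#> L" for a b
  proof -
    obtain x l where xl: "x \<in> Q" "l \<in> L" "b = x \<otimes> l" using b by (auto simp: set_mult_def)
    have "b \<otimes> a = x \<otimes> (l \<otimes> a)" using xl a sub Qsub Lsub by (auto simp: m_assoc subset_iff)
    then show ?thesis using Q_left left xl a by metis
  qed
  have "N <#> L = (Q <#> L) \<union> set_inv (Q <#> L) \<union> L"
  proof (intro equalityI subsetI)
    fix g assume "g \<in> N <#> L"
    then obtain x l where xl: "x \<in> N" "l \<in> L" "g = x \<otimes> l" by (auto simp: set_mult_def)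
    have c: "x \<in> carrier G" "l \<in> carrier G" using xl Nsub Lsub by auto
    consider "x \<in> Q" | "inv x \<in> Q" | "x = \<one>"
      using xl(1) Qsub by (auto simp: N mem_set_inv_iff)
    then show "g \<in> (Q <#> L) \<union> set_inv (Q <#> L) \<union> L"
    proof cases
      case 2
      have il: "inv l \<in> L" using xl(2) subgroup.m_inv_closed[OF L] by blast
      have "inv x \<otimes> \<one> \<in> Q <#> L" using 2 mem subgroup.one_closed[OF L] by blast
      then have "inv l \<otimes> inv x \<in> Q <#> L" using left il c by simp
      then show ?thesis using c xl(3) sub by (simp add: mem_set_inv_iff inv_mult_group)
    qed (use xl c mem in auto)
  next
    fix g assume "g \<in> (Q <#> L) \<union> set_inv (Q <#> L) \<union> L"
    then consider "g \<in> Q <#> L" | "inv g \<in> Q <#> L" "g \<in> carrier G" | "g \<in> L"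
      using sub by (auto simp: mem_set_inv_iff)
    then show "g \<in> N <#> L"
    proof cases
      case 1 then show ?thesis by (auto simp: N set_mult_def)
    next
      case 2
      then obtain x l where xl: "x \<in> Q" "l \<in> L" "inv g = x \<otimes> l" by (auto simp: set_mult_def)
      have c: "x \<in> carrier G" "l \<in> carrier G" using xl Qsub Lsub by auto
      have il: "inv l \<in> L" using xl(2) subgroup.m_inv_closed[OF L] by blast
      let ?y = "inv l \<otimes> x \<otimes> inv (inv l)"
      have y: "?y \<in> Q" using conj il xl(1) by blast
      have "g = inv (x \<otimes> l)" using 2 xl(3) by (metis inv_inv)
      also have "\<dots> = inv ?y \<otimes> inv l" using c by (simp add: inv_mult_group m_assoc)
      finally have "g = inv ?y \<otimes> inv l" .
      moreover have "inv ?y \<in> N" using y by (auto simp: N SET_INV_def)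
      ultimately show ?thesis using il unfolding set_mult_def by blast
    next
      case 3
      then have "g = \<one> \<otimes> g" "\<one> \<in> N" using Lsub by (auto simp: N)
      then show ?thesis using 3 unfolding set_mult_def by blast
    qed
  qed
  moreover have "(Q <#> L) \<inter> L = {}"
  proof (rule ccontr)
    assume "\<not> ?thesis"
    then obtain x l where xl: "x \<in> Q" "l \<in> L" "x \<otimes> l \<in> L" by (auto simp: set_mult_def)
    then have "(x \<otimes> l) \<otimes> inv l \<in> L"
      using subgroup.m_closed[OF L] subgroup.m_inv_closed[OF L] by blast
    then have "x \<in> L" using xl Qsub Lsub by (auto simp: m_assoc subset_iff)
    moreover have "x \<in> N" using xl(1) by (simp add: N)
    ultimately have "x \<in> N \<inter> L" using \<open>x \<in> L\<close> by simp
    then show False using xl(1) trivial one by simp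
  qed
  ultimately show ?thesis using sub L left right both unfolding relative_cone_def by blast
qed

section \<open>Automorphisms that fix every positive cone\<close>

text \<open>
  The action is a homomorphism into a permutation group, so its injectivity can be tested on the kernel.
\<close>

lemma faithful_Aut_LO_iff:
  "faithful_action (AutoGroup G) (LO G) (Aut_LO_action G) \<longleftrightarrow>
    (\<forall>\<phi>\<in>auto G. (\<forall>P\<in>LO G. \<phi> ` P = P) \<longrightarrow> (\<forall>x\<in>carrier G. \<phi> x = x))"
    (is "_ \<longleftrightarrow> ?R")
proof -
  interpret a: group_action "AutoGroup G" "LO G" "Aut_LO_action G"
    by (rule group_action_Aut_LO)
  interpret h: group_hom "AutoGroup G" "BijGroup (LO G)" "Aut_LO_action G"
    by (rule a.group_hom)
  have car: "carrier (AutoGroup G) = auto G" by (simp add: AutoGroup_def)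
  have id: "\<one>\<^bsub>AutoGroup G\<^esub> = (\<lambda>x\<in>carrier G. x)" by (simp add: AutoGroup_def BijGroup_def)
  have ker: "\<phi> \<in> kernel (AutoGroup G) (BijGroup (LO G)) (Aut_LO_action G) \<longleftrightarrow>
      \<phi> \<in> auto G \<and> (\<forall>P\<in>LO G. \<phi> ` P = P)" for \<phi>
    by (auto simp: kernel_def car BijGroup_def Aut_LO_action_def fun_eq_iff restrict_def)
  have eq_id: "\<phi> = (\<lambda>x\<in>carrier G. x) \<longleftrightarrow> (\<forall>x\<in>carrier G. \<phi> x = x)" if "\<phi> \<in> auto G" for \<phi>
    using that by (auto simp: auto_def Bij_def extensional_def fun_eq_iff)
  have "faithful_action (AutoGroup G) (LO G) (Aut_LO_action G) \<longleftrightarrow>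
      inj_on (Aut_LO_action G) (carrier (AutoGroup G))"
    by (simp add: faithful_action_def faithful_action_axioms_def a.group_action_axioms)
  also have "\<dots> \<longleftrightarrow>
      kernel (AutoGroup G) (BijGroup (LO G)) (Aut_LO_action G) \<subseteq> {\<lambda>x\<in>carrier G. x}"
    unfolding h.inj_iff_trivial_ker id using subgroup.one_closed[OF h.subgroup_kernel] id by auto
  also have "\<dots> \<longleftrightarrow> (\<forall>\<phi>\<in>auto G. (\<forall>P\<in>LO G. \<phi> ` P = P) \<longrightarrow> \<phi> = (\<lambda>x\<in>carrier G. x))"
    by (simp only: subset_iff ker singleton_iff Ball_def imp_conjL)
  also have "\<dots> \<longleftrightarrow> ?R" using eq_id by simp
  finally show ?thesis .
qed

text \<open>
  The restriction of \<open>\<phi>\<close> to the image of \<open>K\<close>, transported back along \<open>\<iota>\<close>, is an automorphism of \<open>K\<close> that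
  fixes every positive cone of \<open>K\<close>, so faithfulness for \<open>K\<close> applies to it.
\<close>

lemma fixes_embedded_faithful_subgroup:
  assumes K: "group K" and \<iota>: "\<iota> \<in> mon K G"
    and faithful: "faithful_action (AutoGroup K) (LO K) (Aut_LO_action K)"
    and hom: "\<phi> \<in> hom G G" and inj: "inj_on \<phi> (carrier G)"
    and fix_K: "\<phi> ` \<iota> ` carrier K = \<iota> ` carrier K"
    and fix_LO: "\<And>Q. Q \<in> LO K \<Longrightarrow> \<phi> ` \<iota> ` Q = \<iota> ` Q"
    and x: "x \<in> carrier K"
  shows "\<phi> (\<iota> x) = \<iota> x"
proof -
  interpret K: group K by fact
  interpret \<iota>: group_hom K G \<iota>
    using \<iota> by unfold_locales (auto simp: mon_def)
  have inj_\<iota>: "inj_on \<iota> (carrier K)" using \<iota> by (simp add: mon_def)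
  \<comment> \<open>The restriction makes \<open>\<psi>\<close> extensional, as membership in \<open>auto K\<close> demands.\<close>
  define \<psi> where "\<psi> = (\<lambda>k\<in>carrier K. inv_into (carrier K) \<iota> (\<phi> (\<iota> k)))"
  have \<psi>: "\<psi> k \<in> carrier K" "\<iota> (\<psi> k) = \<phi> (\<iota> k)" if "k \<in> carrier K" for k
  proof -
    have "\<phi> (\<iota> k) \<in> \<iota> ` carrier K" using that fix_K by blast
    then show "\<psi> k \<in> carrier K" "\<iota> (\<psi> k) = \<phi> (\<iota> k)"
      using that by (auto simp: \<psi>_def inv_into_into f_inv_into_f)
  qed
  have image: "\<psi> ` S = S" if S: "S \<subseteq> carrier K" "\<phi> ` \<iota> ` S = \<iota> ` S" for S
  proof -
    have "\<iota> ` \<psi> ` S = \<phi> ` \<iota> ` S"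
      using S(1) \<psi>(2) by (auto simp: image_image subset_iff intro!: image_cong)
    then show ?thesis
      using S \<psi>(1) inj_on_image_eq_iff[OF inj_\<iota>, of "\<psi> ` S" S] by (metis image_subset_iff subsetD)
  qed
  have "inj_on \<psi> (carrier K)"
  proof (rule inj_onI)
    fix a b assume ab: "a \<in> carrier K" "b \<in> carrier K" "\<psi> a = \<psi> b"
    then have "\<phi> (\<iota> a) = \<phi> (\<iota> b)" using \<psi>(2) by metis
    then have "\<iota> a = \<iota> b" using ab inj by (auto dest: inj_onD)
    then show "a = b" using ab inj_\<iota> by (auto dest: inj_onD)
  qed
  then have "bij_betw \<psi> (carrier K) (carrier K)"
    using image[of "carrier K"] fix_K by (simp add: bij_betw_def)
  moreover have "\<psi> (a \<otimes>\<^bsub>K\<^esub> b) = \<psi> a \<otimes>\<^bsub>K\<^esub> \<psi> b" if ab: "a \<in> carrier K" "b \<in> carrier K" for a b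
  proof (rule inj_onD[OF inj_\<iota>])
    show "\<iota> (\<psi> (a \<otimes>\<^bsub>K\<^esub> b)) = \<iota> (\<psi> a \<otimes>\<^bsub>K\<^esub> \<psi> b)"
      using ab \<psi> hom by (simp add: hom_mult)
  qed (use ab \<psi> in auto)
  ultimately have "\<psi> \<in> auto K"
    using \<psi>(1) by (auto simp: auto_def hom_def Bij_def \<psi>_def)
  moreover have "\<psi> ` Q = Q" if "Q \<in> LO K" for Q
    using image[OF _ fix_LO[OF that]] that by (auto simp: LO_def positive_cone_def)
  ultimately have "\<psi> x = x" using faithful x K.faithful_Aut_LO_iff by blast
  then show ?thesis using \<psi>(2)[OF x] by simp
qed

text \<open>
  If \<open>\<phi> t = t\<^sup>n\<close> and \<open>t = \<phi> (t\<^sup>m)\<close> with \<open>n\<close> and \<open>m\<close> positive, then \<open>n m = 1\<close> by freeness, so \<open>n = 1\<close>; positivity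
  rules out the inversion \<open>t \<mapsto> t\<inverse>\<close>.
\<close>

lemma fixes_infinite_cyclic_generator:
  assumes hom: "\<phi> \<in> hom G G" and t: "t \<in> carrier G"
    and free: "\<And>n::int. t [^] n = \<one> \<Longrightarrow> n = 0"
    and fix_pos: "\<phi> ` (\<lambda>n::int. t [^] n) ` {0<..} = (\<lambda>n::int. t [^] n) ` {0<..}"
  shows "\<phi> t = t"
proof -
  interpret \<phi>: group_hom G G \<phi> using hom by unfold_locales
  have "t = t [^] (1::int)" using t by simp
  then have t_pos: "t \<in> (\<lambda>n::int. t [^] n) ` {0<..}" by (metis greaterThan_iff imageI zero_less_one)
  then have "\<phi> t \<in> (\<lambda>n::int. t [^] n) ` {0<..}" using fix_pos by blast
  then obtain n :: int where n: "n > 0" "\<phi> t = t [^] n" by auto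
  have "t \<in> \<phi> ` (\<lambda>n::int. t [^] n) ` {0<..}" using t_pos fix_pos by simp
  then obtain m :: int where m: "m > 0" "t = \<phi> (t [^] m)" by auto
  have "t = t [^] (n * m)" using m(2) n(2) t by (simp add: \<phi>.hom_int_pow int_pow_pow)
  then have "t [^] (n * m - 1) = \<one>"
    using t int_pow_diff[OF t, of "n * m" 1] by simp
  then have "n * m = 1" using free by fastforce
  then have "n = 1" using n(1) m(1) by (simp add: pos_zmult_eq_1_iff)
  then show ?thesis using n(2) t by simp
qed

end

section \<open>Extensions by the integers\<close>

lemma generates_integer_group_imp:
  assumes "generate integer_group {a} = carrier integer_group"
  shows "a = 1 \<or> a = -1"
proof -
  have "(1::int) \<in> generate integer_group {a}" using assms by simp
  then obtain k :: int where "1 = a [^]\<^bsub>integer_group\<^esub> k"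
    using group.generate_pow[OF group_integer_group, of a] by auto
  then have "a dvd 1" by (metis dvd_triv_right group_int_pow_integer_group)
  then have "\<bar>a\<bar> = 1" by (simp only: zdvd1_eq)
  then show ?thesis by linarith
qed

theorem theorem1p3:
  fixes K :: "('k, 'm) monoid_scheme"
    and G :: "('g, 'n) monoid_scheme"
    and \<iota> :: "'k \<Rightarrow> 'g"
    and \<pi> :: "'g \<Rightarrow> int"
    and t :: 'g
    and P\<^sub>K :: "'k set"
  assumes "group K" and "group G"
    and "left_orderable G"
    and "\<iota> \<in> mon K G"
    and "\<pi> \<in> epi G integer_group"
    and "\<iota> ` carrier K = kernel G integer_group \<pi>"
    and "faithful_action (AutoGroup K) (LO K) (Aut_LO_action K)"
    and "t \<in> carrier G"
    and "generate integer_group {\<pi> t} = carrier integer_group"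
    and "P\<^sub>K \<in> LO K"
    and "(t <#\<^bsub>G\<^esub> (\<iota> ` P\<^sub>K)) #>\<^bsub>G\<^esub> (inv\<^bsub>G\<^esub> t) = \<iota> ` P\<^sub>K"
  shows "faithful_action (AutoGroup G) (LO G) (Aut_LO_action G)"
proof -
  interpret G: group G by fact
  interpret \<pi>: group_hom G integer_group \<pi>
    using assms(5) by (simp add: group_hom_def group_hom_axioms_def epi_def)
  let ?N = "\<iota> ` carrier K" and ?Q = "\<iota> ` P\<^sub>K" and ?T = "range (\<lambda>n::int. t [^]\<^bsub>G\<^esub> n)"
  let ?A = "{g \<in> carrier G. \<pi> g > 0}"
  have \<pi>_t: "\<pi> t = 1 \<or> \<pi> t = -1" using assms(9) by (rule generates_integer_group_imp)
  have \<pi>_pow: "\<pi> (t [^]\<^bsub>G\<^esub> n) = n * \<pi> t" for n :: int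
    using \<open>t \<in> carrier G\<close> by (simp add: \<pi>.hom_int_pow)
  have N: "?N = {g \<in> carrier G. \<pi> g = 0}" using assms(6) by (simp add: kernel_def)
  have free: "n = 0" if "t [^]\<^bsub>G\<^esub> n = \<one>\<^bsub>G\<^esub>" for n :: int
    using \<pi>_pow[of n] \<pi>_t that by auto
  have T: "subgroup ?T G"
    using G.generate_is_subgroup[of "{t}"] G.generate_pow[of t] \<open>t \<in> carrier G\<close>
    by (simp add: full_SetCompr_eq)
  have decomp: "\<exists>k\<in>carrier K. \<exists>n::int. g = \<iota> k \<otimes>\<^bsub>G\<^esub> t [^]\<^bsub>G\<^esub> n" if g: "g \<in> carrier G" for g
  proof -
    \<comment> \<open>Since \<open>\<pi> t\<close> is \<open>1\<close> or \<open>-1\<close>, its square is \<open>1\<close>, so this power of \<open>t\<close> lies over \<open>\<pi> g\<close>.\<close>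
    let ?n = "\<pi> g * \<pi> t"
    have tn: "t [^]\<^bsub>G\<^esub> ?n \<in> carrier G" using \<open>t \<in> carrier G\<close> by simp
    have "\<pi> (t [^]\<^bsub>G\<^esub> ?n) = \<pi> g" using \<pi>_pow[of ?n] \<pi>_t by auto
    then have "g \<otimes>\<^bsub>G\<^esub> inv\<^bsub>G\<^esub> (t [^]\<^bsub>G\<^esub> ?n) \<in> ?N" using g tn by (simp add: N)
    then obtain k where "k \<in> carrier K" "g \<otimes>\<^bsub>G\<^esub> inv\<^bsub>G\<^esub> (t [^]\<^bsub>G\<^esub> ?n) = \<iota> k" by auto
    moreover from this have "g = \<iota> k \<otimes>\<^bsub>G\<^esub> t [^]\<^bsub>G\<^esub> ?n"
      using g tn by (metis G.inv_closed G.inv_solve_right' G.m_closed)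
    ultimately show ?thesis by blast
  qed
  \<comment> \<open>The ordering of \<open>G\<close> dominated by the quotient, with \<open>K\<close> convex.\<close>
  have cone_N: "relative_cone G (carrier G) ?N ?A"
    using G.relative_cone_positive_hom[OF \<pi>.homh] assms(6) by simp
  have cone_K: "relative_cone G ?N {\<one>\<^bsub>G\<^esub>} (\<iota> ` Q)" if "Q \<in> LO K" for Q
    using G.relative_cone_image[OF assms(1,4) that] .
  have cone_powers: "relative_cone G ?T {\<one>\<^bsub>G\<^esub>} ((\<lambda>n::int. t [^]\<^bsub>G\<^esub> n) ` {0<..})"
    using G.relative_cone_positive_powers[OF \<open>t \<in> carrier G\<close> free] .
  \<comment> \<open>The ordering of \<open>G\<close> dominated by \<open>K\<close>, with the powers of \<open>t\<close> convex.\<close>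
  have cone_T: "relative_cone G (carrier G) ?T (?Q <#>\<^bsub>G\<^esub> ?T)"
  proof -
    have Q: "?Q \<subseteq> carrier G" using cone_K[OF assms(10)] by (simp add: relative_cone_def)
    then have "t \<in> normalizer G ?Q"
      using assms(8,11) by (simp add: normalizer_def stabilizer_def)
    then have "?T \<subseteq> normalizer G ?Q"
      using G.subgroup_int_pow_closed[OF G.normalizer_imp_subgroup[OF Q]] by blast
    moreover have "?N \<inter> ?T = {\<one>\<^bsub>G\<^esub>}"
    proof -
      have "x = \<one>\<^bsub>G\<^esub>" if x: "x \<in> ?N" "x \<in> ?T" for x
      proof -
        obtain n :: int where n: "x = t [^]\<^bsub>G\<^esub> n" using x(2) by blast
        then have "n = 0" using x(1) \<pi>_pow[of n] \<pi>_t by (auto simp: N)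
        then show ?thesis using n by simp
      qed
      moreover have "\<one>\<^bsub>G\<^esub> \<in> ?N" by (simp add: N)
      moreover have "\<one>\<^bsub>G\<^esub> \<in> ?T" using T by (rule subgroup.one_closed)
      ultimately show ?thesis by blast
    qed
    moreover have "?N <#>\<^bsub>G\<^esub> ?T = carrier G"
    proof
      show "?N <#>\<^bsub>G\<^esub> ?T \<subseteq> carrier G"
        using subgroup.subset[OF T] by (intro G.set_mult_closed) (auto simp: N)
      show "carrier G \<subseteq> ?N <#>\<^bsub>G\<^esub> ?T"
        using decomp by (fastforce simp: set_mult_def)
    qed
    ultimately show ?thesis
      using G.relative_cone_set_mult[OF cone_K[OF assms(10)] T] by simp
  qed
  have "\<phi> g = g" if \<phi>: "\<phi> \<in> auto G" and fix_LO: "\<forall>P\<in>LO G. \<phi> ` P = P" and g: "g \<in> carrier G" for \<phi> g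
  proof -
    have hom: "\<phi> \<in> hom G G" and inj: "inj_on \<phi> (carrier G)"
      using \<phi> by (auto simp: auto_def Bij_def bij_betw_def)
    interpret \<phi>: group_hom G G \<phi> using hom by unfold_locales
    have fix_P: "\<And>P. P \<in> LO G \<Longrightarrow> \<phi> ` P = P" using fix_LO by blast
    have "\<phi> ` ?N = ?N"
      using G.fixes_convex_subgroup[OF hom inj fix_P cone_N cone_K[OF assms(10)]] by blast
    moreover have "\<phi> ` \<iota> ` Q = \<iota> ` Q" if "Q \<in> LO K" for Q
      using G.fixes_relative_cones(2)[OF inj fix_P cone_N cone_K[OF that]] by blast
    ultimately have fix_K: "\<phi> (\<iota> k) = \<iota> k" if "k \<in> carrier K" for k
      using G.fixes_embedded_faithful_subgroup[OF assms(1,4,7) hom inj _ _ that] by blast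
    have "\<phi> ` (\<lambda>n::int. t [^]\<^bsub>G\<^esub> n) ` {0<..} = (\<lambda>n::int. t [^]\<^bsub>G\<^esub> n) ` {0<..}"
      using G.fixes_relative_cones(2)[OF inj fix_P cone_T cone_powers] by blast
    then have fix_t: "\<phi> t = t"
      using G.fixes_infinite_cyclic_generator[OF hom \<open>t \<in> carrier G\<close> free] by blast
    obtain k and n :: int where k: "k \<in> carrier K" and g_eq: "g = \<iota> k \<otimes>\<^bsub>G\<^esub> t [^]\<^bsub>G\<^esub> n"
      using decomp[OF g] by blast
    have "\<iota> k \<in> carrier G" using k N by blast
    then show ?thesis
      using \<open>t \<in> carrier G\<close> fix_K[OF k] fix_t by (simp add: g_eq \<phi>.hom_int_pow)
  qed
  then show ?thesis using G.faithful_Aut_LO_iff by blast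
qed

end
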